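(* Let $f\in\mathcal{G}_{sh}$ with $f(z)=z+\sum_{n=2}^{\infty}a_nz^n$. Then for every $\lambda\in\mathbb{C}$ $$\left|a_3-\lambda a_2^2\right|\le\frac12\max\{1,|2\lambda-1|\},$$ and $$|a_4-a_2a_3|\le\frac13.$$
   Context: $\mathbb{D}=\{z\in\mathbb{C}:|z|<1\}$. $\mathcal{A}$ is the class of analytic functions on $\mathbb{D}$ of the form $f(z)=z+\sum_{n=2}^\infty a_nz^n$. Subordination: $f_1\prec f_2$ means there is a Schwarz function $\omega$ (analytic on $\mathbb{D}$, $|\omega(z)|\le|z|$) with $f_1(z)=f_2(\omega(z))$ for $z\in\mathbb{D}$. The class $\mathcal{G}_{sh}$ is $$\mathcal{G}_{sh}=\left\{f\in\mathcal{A}:\frac{zf'(z)}{f(z)}-1\prec\sinh(z)\right\}.$$ *)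

theory Defs
  imports "HOL-Complex_Analysis.Complex_Analysis"
begin

abbreviation unit_disc :: "complex set" where
  "unit_disc \<equiv> ball 0 1"

text \<open>The expansion \<open>f(z) = z + a\<^sub>2 z\<^sup>2 + a\<^sub>3 z\<^sup>3 + \<dots>\<close> on the unit disc;
  the values \<open>a 0\<close> and \<open>a 1\<close> play no role.\<close>

definition has_normalized_expansion :: "(complex \<Rightarrow> complex) \<Rightarrow> (nat \<Rightarrow> complex) \<Rightarrow> bool" where
  "has_normalized_expansion f a \<longleftrightarrow>
     (\<forall>z\<in>unit_disc. (\<lambda>n. a (n + 2) * z ^ (n + 2)) sums (f z - z))"

definition class_A :: "(complex \<Rightarrow> complex) set" where
  "class_A = {f. f holomorphic_on unit_disc \<and> (\<exists>a. has_normalized_expansion f a)}"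

definition schwarz_function :: "(complex \<Rightarrow> complex) \<Rightarrow> bool" where
  "schwarz_function \<omega> \<longleftrightarrow>
     \<omega> holomorphic_on unit_disc \<and> (\<forall>z\<in>unit_disc. norm (\<omega> z) \<le> norm z)"

definition subordinate :: "(complex \<Rightarrow> complex) \<Rightarrow> (complex \<Rightarrow> complex) \<Rightarrow> bool" where
  "subordinate f g \<longleftrightarrow>
     (\<exists>\<omega>. schwarz_function \<omega> \<and> (\<forall>z\<in>unit_disc. f z = g (\<omega> z)))"

text \<open>The function \<open>z f'(z) / f(z)\<close>, with its removable singularity at \<open>0\<close> filled in
  by the limit value \<open>1\<close> (for \<open>f\<close> in \<open>class_A\<close>).\<close>

definition starlike_quotient :: "(complex \<Rightarrow> complex) \<Rightarrow> complex \<Rightarrow> complex" where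
  "starlike_quotient f z = (if z = 0 then 1 else z * deriv f z / f z)"

text \<open>No separate condition that \<open>f\<close> has no zero in the punctured disc is needed: the
  quotient would be unbounded near such a zero, whereas \<open>sinh \<circ> \<omega>\<close> is continuous.\<close>

definition class_G_sh :: "(complex \<Rightarrow> complex) set" where
  "class_G_sh = {f \<in> class_A. subordinate (\<lambda>z. starlike_quotient f z - 1) sinh}"

end

theory Submission imports Defs
begin

text \<open>Write \<open>z f'(z)/f(z) = 1 + sinh (\<omega>(z))\<close> with \<open>\<omega>(z) = c\<^sub>1 z + c\<^sub>2 z\<^sup>2 + c\<^sub>3 z\<^sup>3 + \<dots>\<close>. Comparing
  coefficients gives \<open>a\<^sub>3 - \<mu> a\<^sub>2\<^sup>2 = (c\<^sub>2 + (1 - 2\<mu>) c\<^sub>1\<^sup>2)/2\<close>, and in \<open>a\<^sub>4 - a\<^sub>2 a\<^sub>3\<close> the mixed terms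
  \<open>c\<^sub>1 c\<^sub>2\<close> cancel, leaving \<open>(c\<^sub>3 - (5/6) c\<^sub>1\<^sup>3)/3\<close>. Both bounds then follow from Wiener's inequality
  \<open>|b\<^sub>n| \<le> 1 - |b\<^sub>0|\<^sup>2\<close> for the coefficients of the bounded function \<open>\<omega>(z)/z\<close>.\<close>

section \<open>Coefficient estimates for bounded analytic functions and Schwarz functions\<close>

text \<open>Cauchy's estimate on the circle of radius \<open>r < 1\<close>, followed by
  \<open>r\<close> tending to 1, since \<open>h\<close> is controlled only on the open disc.\<close>

lemma norm_fps_nth_le_1:
  fixes h :: "complex \<Rightarrow> complex"
  assumes hol: "h holomorphic_on unit_disc"
    and bound: "\<And>z. norm z < 1 \<Longrightarrow> norm (h z) \<le> 1"
    and H: "h has_fps_expansion H"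
  shows "norm (fps_nth H n) \<le> 1"
proof -
  have *: "r ^ n * norm (fps_nth H n) \<le> 1" if r: "0 < r" "r < 1" for r :: real
  proof -
    have "norm ((deriv ^^ n) h 0) \<le> fact n * 1 / r ^ n"
    proof (rule Cauchy_inequality)
      show "h holomorphic_on ball 0 r"
        using hol r by (rule_tac holomorphic_on_subset) auto
      show "continuous_on (cball 0 r) h"
        using hol r by (intro holomorphic_on_imp_continuous_on, rule_tac holomorphic_on_subset) auto
    qed (use r bound in auto)
    then show ?thesis
      using r by (simp add: fps_nth_fps_expansion[OF H] norm_divide field_simps)
  qed
  have "((\<lambda>r. r ^ n * norm (fps_nth H n)) \<longlongrightarrow> 1 ^ n * norm (fps_nth H n)) (at_left 1)"
    by (intro tendsto_intros)
  moreover have "\<forall>\<^sub>F r in at_left (1::real). r ^ n * norm (fps_nth H n) \<le> 1"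
    by (rule eventually_mono[OF eventually_at_left_real[of 0 1]]) (use * in auto)
  ultimately have "1 ^ n * norm (fps_nth H n) \<le> 1"
    by (rule tendsto_upperbound) simp
  then show ?thesis by simp
qed

text \<open>The disc automorphism sending \<open>b\<close> = \<open>\<phi> 0\<close> to 0 turns
  \<open>\<phi>\<close> into a self-map \<open>h\<close> of the disc with \<open>h 0 = 0\<close>.
  Clearing its denominator and comparing coefficients at index \<open>n\<close> gives
  \<open>F_n = H_n * (1 - |b|^2)\<close>, where \<open>|H_n|\<close> is at most 1.\<close>

lemma norm_fps_nth_gap_le:
  fixes \<phi> :: "complex \<Rightarrow> complex"
  assumes hol: "\<phi> holomorphic_on unit_disc"
    and bound: "\<And>z. norm z < 1 \<Longrightarrow> norm (\<phi> z) < 1"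
    and F: "\<phi> has_fps_expansion F"
    and n: "n > 0"
    and gap: "\<And>m. \<lbrakk>0 < m; m < n\<rbrakk> \<Longrightarrow> fps_nth F m = 0"
  shows "norm (fps_nth F n) \<le> 1 - (norm (fps_nth F 0))\<^sup>2"
proof -
  define b where "b = fps_nth F 0"
  have b: "b = \<phi> 0"
    by (simp add: b_def fps_nth_fps_expansion[OF F])
  have nb: "norm b < 1" using bound[of 0] by (simp add: b)
  have pos: "0 < 1 - (norm b)\<^sup>2"
    using nb by (simp add: power_less_one_iff)
  define h where "h = Moebius_function 0 b \<circ> \<phi>"
  have hol_h: "h holomorphic_on unit_disc"
    unfolding h_def
    by (rule holomorphic_on_compose_gen[OF hol Moebius_function_holomorphic[OF nb]])
      (use bound in auto)
  have bound_h: "norm (h z) < 1" if "norm z < 1" for z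
    unfolding h_def o_def by (rule Moebius_function_norm_lt_1[OF nb bound[OF that]])
  define H where "H = fps_expansion h 0"
  have H: "h has_fps_expansion H"
    unfolding H_def by (rule has_fps_expansion_fps_expansion[OF _ _ hol_h]) auto
  have H0: "fps_nth H 0 = 0"
    by (simp add: fps_nth_fps_expansion[OF H] h_def b Moebius_function_eq_zero)
  have "H * (1 - fps_const (cnj b) * F) = F - fps_const b"
  proof (rule fps_expansion_unique_complex)
    have "(\<lambda>z. h z * (1 - cnj b * \<phi> z)) has_fps_expansion H * (1 - fps_const (cnj b) * F)"
      by (intro fps_expansion_intros H F)
    moreover have "\<forall>\<^sub>F z in nhds 0. h z * (1 - cnj b * \<phi> z) = \<phi> z - b"
    proof -
      have "\<forall>\<^sub>F z in nhds (0::complex). z \<in> unit_disc"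
        by (intro eventually_nhds_in_open) auto
      then show ?thesis
      proof eventually_elim
        case (elim z)
        have "norm (cnj b * \<phi> z) < 1"
          using nb bound[of z] elim mult_strict_mono'[of "norm b" 1 "norm (\<phi> z)" 1]
          by (simp add: norm_mult)
        then have "1 - cnj b * \<phi> z \<noteq> 0" by auto
        then show ?case by (simp add: h_def Moebius_function_simple)
      qed
    qed
    ultimately show "(\<lambda>z. \<phi> z - b) has_fps_expansion H * (1 - fps_const (cnj b) * F)"
      by (simp cong: has_fps_expansion_cong)
    show "(\<lambda>z. \<phi> z - b) has_fps_expansion F - fps_const b"
      by (intro fps_expansion_intros F)
  qed
  then have "fps_nth (H * (1 - fps_const (cnj b) * F)) n = fps_nth F n"
    using n by simp
  \<comment> \<open>In the Cauchy product the term \<open>i = 0\<close> vanishes by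
    \<open>H0\<close>, and the terms with \<open>0 < i < n\<close> vanish by \<open>gap\<close> at
    index \<open>n - i\<close>.\<close>
  also have "fps_nth (H * (1 - fps_const (cnj b) * F)) n
      = (\<Sum>i\<in>{0..n}. if i = n then fps_nth H n * (1 - cnj b * b) else 0)"
    unfolding fps_mult_nth
  proof (rule sum.cong)
    fix i assume "i \<in> {0..n}"
    then consider "i = 0" "i \<noteq> n" | "0 < i" "i < n" | "i = n"
      using n by force
    then show "fps_nth H i * fps_nth (1 - fps_const (cnj b) * F) (n - i)
      = (if i = n then fps_nth H n * (1 - cnj b * b) else 0)"
      by cases (use H0 gap[of "n - i"] in \<open>auto simp: b_def\<close>)
  qed simp
  also have "\<dots> = fps_nth H n * (1 - cnj b * b)" by simp
  also have "1 - cnj b * b = of_real (1 - (norm b)\<^sup>2)"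
    using complex_norm_square[of b] by (simp add: mult.commute)
  finally have "norm (fps_nth F n) = norm (fps_nth H n) * (1 - (norm b)\<^sup>2)"
    using pos by (metis norm_mult norm_of_real abs_of_pos)
  moreover have "norm (fps_nth H n) \<le> 1"
    by (rule norm_fps_nth_le_1[OF hol_h _ H]) (use bound_h less_imp_le in blast)
  ultimately show ?thesis
    using pos by (simp add: b_def mult_left_le_one_le)
qed

lemma norm_fps_nth_le_strict:
  fixes \<phi> :: "complex \<Rightarrow> complex"
  assumes hol: "\<phi> holomorphic_on unit_disc"
    and bound: "\<And>z. norm z < 1 \<Longrightarrow> norm (\<phi> z) < 1"
    and F: "\<phi> has_fps_expansion F"
    and n: "n > 0"
  shows "norm (fps_nth F n) \<le> 1 - (norm (fps_nth F 0))\<^sup>2"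
proof -
  \<comment> \<open>Averaging over the \<open>n\<close>-th roots of unity kills the coefficients with index strictly between
      \<open>0\<close> and \<open>n\<close>.\<close>
  define \<zeta> where "\<zeta> = cis (2 * pi / n)"
  have \<zeta>_n: "\<zeta> ^ n = 1"
    using n cis_multiple_2pi[of 1] by (simp add: \<zeta>_def Complex.DeMoivre)
  have norm_\<zeta>: "norm (\<zeta> ^ k * z) = norm z" for k z
    by (simp add: \<zeta>_def norm_mult norm_power)
  \<comment> \<open>That is, \<open>\<zeta>\<close> is a primitive root of unity:
    \<open>\<zeta> ^ m = 1\<close> would force \<open>n\<close> to divide \<open>m\<close>.\<close>
  have \<zeta>_neq: "\<zeta> ^ m \<noteq> 1" if "0 < m" "m < n" for m
  proof
    assume "\<zeta> ^ m = 1"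
    then have "exp (\<i> * of_real (2 * pi * m / n)) = 1"
      by (simp add: \<zeta>_def cis_conv_exp mult_ac flip: exp_of_nat_mult)
    then obtain j :: int where "2 * pi * m / n = of_int (2 * j) * pi"
      by (auto simp: exp_eq_1)
    then have "real m = of_int j * real n"
      using n by (simp add: field_simps)
    then have "int m = j * int n" by (metis of_int_eq_iff of_int_mult of_int_of_nat_eq)
    then have "int n dvd int m" by simp
    then show False using that by (auto dest: dvd_imp_le)
  qed
  define \<psi> where "\<psi> = (\<lambda>z. (1 / of_nat n) * (\<Sum>k<n. (\<phi> \<circ> (\<lambda>z. \<zeta> ^ k * z)) z))"
  define G where "G = fps_const (1 / of_nat n) * (\<Sum>k<n. fps_compose F (fps_const (\<zeta> ^ k) * fps_X))"
  have G: "\<psi> has_fps_expansion G"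
    unfolding \<psi>_def G_def by (intro fps_expansion_intros F) simp
  \<comment> \<open>The averaging factor is 1 for \<open>m = 0\<close> and \<open>m = n\<close>. For
    \<open>0 < m < n\<close> it is a full geometric sum over a nontrivial root of unity, hence
    0.\<close>
  have G_nth: "fps_nth G m = fps_nth F m * ((\<Sum>k<n. (\<zeta> ^ m) ^ k) / of_nat n)" for m
    by (simp add: G_def fps_sum_nth sum_distrib_left sum_divide_distrib flip: power_mult)
      (simp add: mult_ac)
  have "norm (fps_nth G n) \<le> 1 - (norm (fps_nth G 0))\<^sup>2"
  proof (rule norm_fps_nth_gap_le[OF _ _ G n])
    show "\<psi> holomorphic_on unit_disc"
      unfolding \<psi>_def
      by (intro holomorphic_intros holomorphic_on_compose_gen[OF _ hol]) (auto simp: norm_\<zeta>)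
  next
    fix z :: complex assume z: "norm z < 1"
    have "norm (\<Sum>k<n. (\<phi> \<circ> (\<lambda>z. \<zeta> ^ k * z)) z) \<le> (\<Sum>k<n. norm (\<phi> (\<zeta> ^ k * z)))"
      unfolding o_def by (rule norm_sum)
    also have "\<dots> < (\<Sum>k<n. 1)"
      using n z by (intro sum_strict_mono bound) (auto simp: norm_\<zeta>)
    finally show "norm (\<psi> z) < 1"
      using n by (simp add: \<psi>_def norm_divide)
  next
    fix m assume m: "0 < m" "m < n"
    have "(\<zeta> ^ m) ^ n = 1"
      by (metis \<zeta>_n mult.commute power_mult power_one)
    then show "fps_nth G m = 0"
      using \<zeta>_neq[OF m] by (simp add: G_nth geometric_sum)
  qed
  then show ?thesis using n by (simp add: G_nth \<zeta>_n)
qed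

text \<open>The strict bound is applied to \<open>t * \<phi>\<close> with \<open>0 < t < 1\<close>,
  and \<open>t\<close> then tends to 1. This also covers unimodular constants, such as the quotient
  \<open>\<omega>(z)/z\<close> when \<open>\<omega>\<close> is a rotation.\<close>

theorem wiener_coefficient_bound:
  fixes \<phi> :: "complex \<Rightarrow> complex"
  assumes hol: "\<phi> holomorphic_on unit_disc"
    and bound: "\<And>z. norm z < 1 \<Longrightarrow> norm (\<phi> z) \<le> 1"
    and F: "\<phi> has_fps_expansion F"
    and n: "n > 0"
  shows "norm (fps_nth F n) \<le> 1 - (norm (fps_nth F 0))\<^sup>2"
proof -
  have *: "t * norm (fps_nth F n) \<le> 1 - (t * norm (fps_nth F 0))\<^sup>2" if t: "0 < t" "t < 1" for t :: real
  proof -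
    have "norm (fps_nth (fps_const (of_real t) * F) n)
        \<le> 1 - (norm (fps_nth (fps_const (of_real t) * F) 0))\<^sup>2"
    proof (rule norm_fps_nth_le_strict[OF _ _ _ n])
      show "(\<lambda>z. of_real t * \<phi> z) holomorphic_on unit_disc"
        by (intro holomorphic_intros hol)
      show "(\<lambda>z. of_real t * \<phi> z) has_fps_expansion fps_const (of_real t) * F"
        by (intro fps_expansion_intros F)
      fix z :: complex assume "norm z < 1"
      then have "t * norm (\<phi> z) \<le> t * 1"
        using t bound by (intro mult_left_mono) auto
      also have "t * 1 < 1" using t by simp
      finally show "norm (of_real t * \<phi> z) < 1"
        using t by (simp add: norm_mult)
    qed
    then show ?thesis using t by (simp add: norm_mult)
  qed
  show ?thesis
  proof (rule tendsto_le[where F = "at_left (1::real)"])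
    show "((\<lambda>t. t * norm (fps_nth F n)) \<longlongrightarrow> norm (fps_nth F n)) (at_left 1)"
      by (auto intro!: tendsto_eq_intros)
    show "((\<lambda>t. 1 - (t * norm (fps_nth F 0))\<^sup>2) \<longlongrightarrow> 1 - (norm (fps_nth F 0))\<^sup>2) (at_left 1)"
      by (auto intro!: tendsto_eq_intros)
    show "\<forall>\<^sub>F t in at_left 1. t * norm (fps_nth F n) \<le> 1 - (t * norm (fps_nth F 0))\<^sup>2"
      by (rule eventually_mono[OF eventually_at_left_real[of 0 1]]) (use * in auto)
  qed simp
qed

text \<open>Dividing \<omega> by \<open>z\<close> lowers every index by one, so \<open>n > 1\<close>
  here is the case of positive index \<open>n - 1\<close> in Wiener's inequality.\<close>

corollary schwarz_function_coefficient_bound: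
  assumes "schwarz_function \<omega>" and W: "\<omega> has_fps_expansion W"
  shows "fps_nth W 0 = 0" and "norm (fps_nth W 1) \<le> 1"
    and "n > 1 \<Longrightarrow> norm (fps_nth W n) \<le> 1 - (norm (fps_nth W 1))\<^sup>2"
proof -
  have hol: "\<omega> holomorphic_on unit_disc" and le: "\<And>z. norm z < 1 \<Longrightarrow> norm (\<omega> z) \<le> norm z"
    using assms by (auto simp: schwarz_function_def)
  have [simp]: "\<omega> 0 = 0" using le[of 0] by simp
  define \<phi> where "\<phi> = (\<lambda>z. if z = 0 then deriv \<omega> 0 else (\<omega> z - \<omega> 0) / (z - 0))"
  have hol_\<phi>: "\<phi> holomorphic_on unit_disc"
    unfolding \<phi>_def by (rule pole_lemma_open[OF hol]) simp
  define P where "P = fps_expansion \<phi> 0"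
  have P: "\<phi> has_fps_expansion P"
    unfolding P_def by (rule has_fps_expansion_fps_expansion[OF _ _ hol_\<phi>]) auto
  have "(\<lambda>z. z * \<phi> z) has_fps_expansion fps_X * P"
    by (intro fps_expansion_intros P)
  also have "(\<lambda>z. z * \<phi> z) = \<omega>"
    by (auto simp: \<phi>_def)
  finally have WP: "W = fps_X * P"
    by (rule fps_expansion_unique_complex[OF W])
  have less: "norm (\<omega> z) < 1" if "norm z < 1" for z
    using le[OF that] that by simp
  have bound: "norm (\<phi> z) \<le> 1" if z: "norm z < 1" for z
  proof (cases "z = 0")
    case True
    then show ?thesis
      \<comment> \<open>At the filled-in point the bound is the derivative part of the Schwarz
        lemma.\<close>
      using Schwarz_Lemma(2)[OF hol _ less, of 0] by (simp add: \<phi>_def)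
  next
    case False
    then show ?thesis
      using le[OF z] by (simp add: \<phi>_def norm_divide divide_simps)
  qed
  show "fps_nth W 0 = 0" by (simp add: WP)
  show "norm (fps_nth W 1) \<le> 1"
    using norm_fps_nth_le_1[OF hol_\<phi> bound P, of 0] by (simp add: WP)
  show "norm (fps_nth W n) \<le> 1 - (norm (fps_nth W 1))\<^sup>2" if "n > 1"
    using wiener_coefficient_bound[OF hol_\<phi> bound P, of "n - 1"] that by (simp add: WP)
qed

section \<open>Power series identities for \<open>class_G_sh\<close>\<close>

text \<open>The outer series is sinh written with exponentials. As
  \<open>sinh w = w + w^3/6 + ...\<close>, composition first alters the coefficients of
  \<open>W\<close> at index 3.\<close>

lemma fps_sinh_compose_nth:
  fixes W :: "'a :: field_char_0 fps"
  assumes W0: "fps_nth W 0 = 0"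
  defines "S \<equiv> fps_compose (fps_const (1/2) * (fps_exp 1 - fps_exp (-1))) W"
  shows "fps_nth S 0 = 0" "fps_nth S 1 = fps_nth W 1" "fps_nth S 2 = fps_nth W 2"
    "fps_nth S 3 = fps_nth W 3 + (fps_nth W 1) ^ 3 / 6"
  using W0 unfolding S_def
  by (simp_all add: fps_compose_nth fps_mult_nth numeral_3_eq_3 numeral_2_eq_2 fact_numeral
      power_Suc algebra_simps)

text \<open>The defining series starts at index 2, so the leading coefficients 0 and 1 of
  \<open>f\<close> are put in by hand.\<close>

lemma has_normalized_expansion_imp_has_fps_expansion:
  assumes "has_normalized_expansion f a"
  shows "f has_fps_expansion Abs_fps (\<lambda>n. if n = 0 then 0 else if n = 1 then 1 else a n)"
proof (rule has_fps_expansionI)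
  let ?c = "\<lambda>n. if n = 0 then 0 else if n = 1 then 1 else a n"
  have "\<forall>\<^sub>F z in nhds (0::complex). z \<in> unit_disc"
    by (intro eventually_nhds_in_open) auto
  then show "\<forall>\<^sub>F z in nhds 0. (\<lambda>n. fps_nth (Abs_fps ?c) n * z ^ n) sums f z"
  proof eventually_elim
    case (elim z)
    then have "(\<lambda>n. ?c (n + 2) * z ^ (n + 2)) sums (f z - (\<Sum>n<2. ?c n * z ^ n))"
      using assms by (auto simp: has_normalized_expansion_def numeral_2_eq_2)
    then show ?case
      by (subst (asm) sums_iff_shift) simp
  qed
qed

text \<open>The nonvanishing of \<open>f\<close> near \<open>0\<close> matters because \<open>starlike_quotient\<close> is junk at zeros of \<open>f\<close>.\<close>

lemma class_G_sh_fps_equation: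
  assumes "f \<in> class_G_sh" and F: "f has_fps_expansion F"
    and F0: "fps_nth F 0 = 0" "fps_nth F 1 = 1"
  obtains \<omega> W where "schwarz_function \<omega>" "\<omega> has_fps_expansion W"
    "fps_X * fps_deriv F
      = F * (1 + fps_compose (fps_const (1/2) * (fps_exp 1 - fps_exp (-1))) W)"
proof -
  obtain \<omega> where \<omega>: "schwarz_function \<omega>"
    and eq: "\<And>z. norm z < 1 \<Longrightarrow> starlike_quotient f z - 1 = sinh (\<omega> z)"
    using assms by (auto simp: class_G_sh_def subordinate_def)
  define W where "W = fps_expansion \<omega> 0"
  have W: "\<omega> has_fps_expansion W"
    using \<omega> unfolding W_def schwarz_function_def
    by (intro has_fps_expansion_fps_expansion[where A = unit_disc]) auto
  let ?S = "fps_const (1/2) * (fps_exp 1 - fps_exp (-1)) :: complex fps"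
  have "(\<lambda>z::complex. (1/2) * (exp z - exp (-z))) has_fps_expansion ?S"
    by (intro fps_expansion_intros)
  then have S: "sinh has_fps_expansion ?S"
    by (simp add: sinh_def [abs_def] scaleR_conv_of_real)
  \<comment> \<open>The quotient equation is multiplied out because \<open>F\<close> has zero
    constant term and hence no inverse power series.\<close>
  have "fps_X * fps_deriv F = F * (1 + fps_compose ?S W)"
  proof (rule fps_expansion_unique_complex)
    show "(\<lambda>z. z * deriv f z) has_fps_expansion fps_X * fps_deriv F"
      by (intro fps_expansion_intros F)
    have "(\<lambda>z. f z * (1 + (sinh \<circ> \<omega>) z)) has_fps_expansion F * (1 + fps_compose ?S W)"
      by (intro fps_expansion_intros F S W schwarz_function_coefficient_bound(1)[OF \<omega> W])
    moreover have "\<forall>\<^sub>F z in nhds 0. f z * (1 + (sinh \<circ> \<omega>) z) = z * deriv f z"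
    proof -
      \<comment> \<open>A nonzero expansion makes the zero of \<open>f\<close> at 0 isolated, so the
        division by \<open>f\<close> can be undone on a punctured neighbourhood. At 0 itself both
        sides vanish.\<close>
      have "F \<noteq> 0" using F0 by auto
      then have "\<forall>\<^sub>F z in at 0. f z \<noteq> 0"
        using F by (intro has_laurent_expansion_nonzero_imp_eventually_nonzero)
          (auto simp: has_fps_expansion_to_laurent)
      then have "\<forall>\<^sub>F z in nhds 0. z \<noteq> 0 \<longrightarrow> f z \<noteq> 0"
        by (simp add: eventually_at_filter)
      moreover have "\<forall>\<^sub>F z in nhds (0::complex). z \<in> unit_disc"
        by (intro eventually_nhds_in_open) auto
      ultimately show ?thesis
      proof eventually_elim
        case (elim z)
        show ?case
        proof (cases "z = 0")
          case True
          then show ?thesis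
            using F F0 by (simp add: has_fps_expansion_to_laurent)
        next
          case False
          then have "1 + sinh (\<omega> z) = z * deriv f z / f z"
            using eq[of z] elim by (simp add: starlike_quotient_def algebra_simps)
          then show ?thesis using elim False by simp
        qed
      qed
    qed
    ultimately show "(\<lambda>z. z * deriv f z) has_fps_expansion F * (1 + fps_compose ?S W)"
      by (simp cong: has_fps_expansion_cong)
  qed
  with \<omega> W show ?thesis by (rule that)
qed

text \<open>Here \<open>c1\<close>, \<open>c2\<close>, \<open>c3\<close> are the first coefficients
  of the Schwarz function \<omega>. The power series equation determines \<open>a 2\<close>,
  \<open>a 3\<close>, \<open>a 4\<close> from them recursively.\<close>

lemma class_G_sh_coefficients:
  assumes "f \<in> class_G_sh" and "has_normalized_expansion f a"
  obtains c1 c2 c3 where "norm c1 \<le> 1" "norm c2 \<le> 1 - (norm c1)\<^sup>2" "norm c3 \<le> 1 - (norm c1)\<^sup>2"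
    "a 2 = c1" "2 * a 3 = c2 + c1\<^sup>2" "3 * a 4 = c3 + 3/2 * c1 * c2 + 2/3 * c1 ^ 3"
proof -
  define F where "F = Abs_fps (\<lambda>n. if n = 0 then 0 else if n = 1 then 1 else a n)"
  have F: "f has_fps_expansion F"
    unfolding F_def by (rule has_normalized_expansion_imp_has_fps_expansion) fact
  have F_nth: "fps_nth F 0 = 0" "fps_nth F 1 = 1" "fps_nth F 2 = a 2" "fps_nth F 3 = a 3"
    "fps_nth F 4 = a 4"
    by (simp_all add: F_def)
  obtain \<omega> W where \<omega>: "schwarz_function \<omega>" and W: "\<omega> has_fps_expansion W"
    and eq: "fps_X * fps_deriv F
      = F * (1 + fps_compose (fps_const (1/2) * (fps_exp 1 - fps_exp (-1))) W)" (is "_ = _ * (1 + ?S)")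
    using class_G_sh_fps_equation[OF assms(1) F F_nth(1,2)] by blast
  note bounds = schwarz_function_coefficient_bound[OF \<omega> W]
  define S where "S = ?S"
  note S_nth = fps_sinh_compose_nth[OF bounds(1), folded S_def]
  \<comment> \<open>The terms \<open>i = 0\<close> and \<open>i = n\<close> vanish since
    \<open>F\<close> and \<open>S\<close> have zero constant term. Thus \<open>(n - 1) * F_n\<close>
    is expressed through earlier coefficients of \<open>F\<close>.\<close>
  have rec: "of_nat n * fps_nth F n = fps_nth F n + (\<Sum>i\<le>n. fps_nth F i * fps_nth S (n - i))" for n
  proof -
    have "of_nat n * fps_nth F n = fps_nth (fps_X * fps_deriv F) n"
      by (cases n) simp_all
    also have "\<dots> = fps_nth (F + F * S) n"
      by (simp add: eq S_def distrib_left)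
    also have "\<dots> = fps_nth F n + (\<Sum>i\<le>n. fps_nth F i * fps_nth S (n - i))"
      by (simp only: fps_add_nth fps_mult_nth atMost_atLeast0)
    finally show ?thesis .
  qed
  have 2: "a 2 = fps_nth W 1"
    using rec[of 2] F_nth S_nth by (simp add: numeral_2_eq_2 algebra_simps)
  have 3: "2 * a 3 = fps_nth W 2 + (fps_nth W 1)\<^sup>2"
    using rec[of 3] F_nth S_nth 2
    by (simp add: numeral_2_eq_2 numeral_3_eq_3 algebra_simps)
  have "3 * a 4 = fps_nth S 3 + a 2 * fps_nth W 2 + a 3 * fps_nth W 1"
    using rec[of 4] F_nth S_nth
    by (simp add: eval_nat_numeral algebra_simps)
  also have "a 3 = (fps_nth W 2 + (fps_nth W 1)\<^sup>2) / 2"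
    using 3 by (simp add: eq_divide_eq mult.commute)
  \<comment> \<open>The cubic coefficient is 1/6 from sinh plus 1/2 from \<open>a 3\<close>; the
    mixed one is 1 + 1/2.\<close>
  also have "fps_nth S 3 + a 2 * fps_nth W 2 + (fps_nth W 2 + (fps_nth W 1)\<^sup>2) / 2 * fps_nth W 1
      = fps_nth W 3 + 3/2 * fps_nth W 1 * fps_nth W 2 + 2/3 * (fps_nth W 1) ^ 3"
    by (simp add: 2 S_nth field_simps power2_eq_square power3_eq_cube)
  finally have "3 * a 4
      = fps_nth W 3 + 3/2 * fps_nth W 1 * fps_nth W 2 + 2/3 * (fps_nth W 1) ^ 3" .
  with 2 3 bounds(2) bounds(3)[of 2] bounds(3)[of 3] show ?thesis
    by (intro that) auto
qed

section \<open>The Fekete-Szego functional and the functional \<open>a 4 - a 2 * a 3\<close>\<close>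

theorem mainTheorem6:
  fixes f :: "complex \<Rightarrow> complex" and a :: "nat \<Rightarrow> complex"
  assumes "f \<in> class_G_sh"
    and "has_normalized_expansion f a"
  shows "(\<forall>\<mu>::complex. norm (a 3 - \<mu> * (a 2)\<^sup>2) \<le> 1 / 2 * max 1 (norm (2 * \<mu> - 1)))
    \<and> norm (a 4 - a 2 * a 3) \<le> 1 / 3"
proof -
  obtain c1 c2 c3 where c: "norm c1 \<le> 1" "norm c2 \<le> 1 - (norm c1)\<^sup>2" "norm c3 \<le> 1 - (norm c1)\<^sup>2"
    and a2: "a 2 = c1" and a3: "2 * a 3 = c2 + c1\<^sup>2"
    and a4: "3 * a 4 = c3 + 3/2 * c1 * c2 + 2/3 * c1 ^ 3"
    using class_G_sh_coefficients[OF assms] by blast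
  have sq: "(norm c1)\<^sup>2 \<le> 1" using c(1) by (simp add: power_le_one)
  have a3': "a 3 = (c2 + c1\<^sup>2) / 2" using a3 by (simp add: eq_divide_eq mult.commute)
  have a4': "a 4 = (c3 + 3/2 * c1 * c2 + 2/3 * c1 ^ 3) / 3"
    using a4 by (metis nonzero_mult_div_cancel_left zero_neq_numeral)
  have "norm (a 3 - \<mu> * (a 2)\<^sup>2) \<le> 1 / 2 * max 1 (norm (2 * \<mu> - 1))" for \<mu>
  proof -
    let ?M = "max 1 (norm (2 * \<mu> - 1))"
    have "a 3 - \<mu> * (a 2)\<^sup>2 = (c2 - (2 * \<mu> - 1) * c1\<^sup>2) / 2" (is "?A = ?B / 2")
      by (simp add: a2 a3' field_simps)
    then have "norm ?A = norm ?B / 2"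
      by (simp only: norm_divide norm_numeral)
    also have "norm (c2 - (2 * \<mu> - 1) * c1\<^sup>2) \<le> norm c2 + norm (2 * \<mu> - 1) * (norm c1)\<^sup>2"
      by (metis norm_triangle_ineq4 norm_mult norm_power)
    \<comment> \<open>The weights \<open>1 - |c1|^2\<close> and \<open>|c1|^2\<close> are
      nonnegative with sum 1, and \<open>?M\<close> dominates both of their factors, 1 and
      \<open>|2 * \<mu> - 1|\<close>.\<close>
    also have "\<dots> \<le> ?M * (1 - (norm c1)\<^sup>2) + ?M * (norm c1)\<^sup>2"
    proof (rule add_mono)
      have "1 * (1 - (norm c1)\<^sup>2) \<le> ?M * (1 - (norm c1)\<^sup>2)"
        using sq by (intro mult_right_mono) auto
      then show "norm c2 \<le> ?M * (1 - (norm c1)\<^sup>2)" using c(2) by simp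
      show "norm (2 * \<mu> - 1) * (norm c1)\<^sup>2 \<le> ?M * (norm c1)\<^sup>2"
        by (intro mult_right_mono) auto
    qed
    also have "\<dots> = ?M" by (simp add: algebra_simps)
    finally show ?thesis by simp
  qed
  moreover have "norm (a 4 - a 2 * a 3) \<le> 1 / 3"
  proof -
    \<comment> \<open>The constant arises as \<open>2/3 - 3/2 = -5/6\<close>.\<close>
    have "a 4 - a 2 * a 3 = (c3 - 5/6 * c1 ^ 3) / 3" (is "?A = ?B / 3")
      by (simp add: a2 a3' a4' field_simps power2_eq_square power3_eq_cube)
    then have "norm ?A = norm ?B / 3"
      by (simp only: norm_divide norm_numeral)
    also have "norm (c3 - 5/6 * c1 ^ 3) \<le> norm c3 + 5/6 * norm c1 ^ 3"
      using norm_triangle_ineq4[of c3 "5/6 * c1 ^ 3"] by (simp add: norm_mult norm_power norm_divide)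
    \<comment> \<open>Lowering the exponent matches the Wiener bound for \<open>c3\<close>: the
      numerator becomes at most \<open>1 - |c1|^2 / 6\<close>.\<close>
    also have "norm c1 ^ 3 \<le> (norm c1)\<^sup>2"
      using c(1) by (intro power_decreasing) auto
    finally have "norm ?A \<le> (norm c3 + 5/6 * (norm c1)\<^sup>2) / 3" by simp
    then show ?thesis using c(3) zero_le_power2[of "norm c1"] by argo
  qed
  ultimately show ?thesis by blast
qed

end
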